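(* Let $\mathcal{X}$ be a finite set, $\pi_0\in\mathcal{P}[\mathcal{X}]$, $f:\mathcal{X}\to\mathbb{R}$ any function, and $\alpha\in\mathbb{R}$. Then $$\min_{\pi}\left[\mathbb{D}_\alpha(\pi_0\|\pi)+\Psi^\alpha_\pi[f]\right]=\Psi^{\alpha-1}_{\pi_0}[f],$$ where the minimum is over all $\pi\in\mathcal{P}[\mathcal{X}]$ for which $\mathbb{D}_\alpha(\pi_0\|\pi)$ is defined, and the minimum is achieved at $$\pi^*(x)=\pi_0(x)\exp\left(-f(x)-\Psi^1_{\pi_0}[-f]\right),\qquad x\in\mathcal{X}.$$
   Context: $\mathcal{P}[\mathcal{X}]$ is the set of probability distributions on the finite set $\mathcal{X}$; $\mathrm{supp}[p]=\{x:p(x)>0\}$. For $p\in\mathcal{P}[\mathcal{X}]$ and $f:\mathcal{X}\to\mathbb{R}$: $\mathrm{E}_p[f]=\sum_x p(x)f(x)$, $\Psi^\beta_p[f]=\beta^{-1}\log\left(\mathrm{E}_p[\exp(\beta f)]\right)$ for $\beta\neq0$, and $\Psi^0_p[f]=\mathrm{E}_p[f]$. Rényi divergence of order $\alpha\in\mathbb{R}$ (with this paper's normalization): for $\alpha\ne 0,1$, $\mathbb{D}_\alpha(p\|q)=\frac{1}{\alpha(\alpha-1)}\log\left(\sum_{x}p(x)^\alpha q(x)^{1-\alpha}\right)$, the sum being over $x\in\mathrm{supp}[p]\cap\mathrm{supp}[q]$; $\mathbb{D}_0(p\|q)=\mathrm{KL}(q\|p)$ and $\mathbb{D}_1(p\|q)=\mathrm{KL}(p\|q)$,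 where $\mathrm{KL}(p\|q)=\sum_x p(x)\log\frac{p(x)}{q(x)}$. It is defined when $\mathrm{supp}[p]\cap\mathrm{supp}[q]\neq\emptyset$ if $\alpha\in(0,1)$, when $\mathrm{supp}[p]\subseteq\mathrm{supp}[q]$ if $\alpha\ge1$, and when $\mathrm{supp}[q]\subseteq\mathrm{supp}[p]$ if $\alpha\le0$. *)

theory Defs
  imports "HOL-Probability.Probability"
begin

definition Psi :: "real \<Rightarrow> 'a::finite pmf \<Rightarrow> ('a \<Rightarrow> real) \<Rightarrow> real" where
  "Psi \<beta> p f =
    (if \<beta> = 0 then measure_pmf.expectation p f
     else ln (measure_pmf.expectation p (\<lambda>x. exp (\<beta> * f x))) / \<beta>)"

(* Terms with pmf p x = 0 vanish, which is the usual convention 0 log (0/q) = 0.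
   The value agrees with the Kullback-Leibler divergence only if
   set_pmf p \<subseteq> set_pmf q; otherwise it is a junk value. *)
definition KL :: "'a::finite pmf \<Rightarrow> 'a pmf \<Rightarrow> real" where
  "KL p q = (\<Sum>x\<in>UNIV. pmf p x * ln (pmf p x / pmf q x))"

(* The normalization is 1 / (\<alpha> (\<alpha> - 1)) rather than the more common 1 / (\<alpha> - 1),
   and \<alpha> ranges over all reals.  The value is meaningful only where
   renyi_defined holds. *)
definition renyi_div :: "real \<Rightarrow> 'a::finite pmf \<Rightarrow> 'a pmf \<Rightarrow> real" where
  "renyi_div \<alpha> p q =
    (if \<alpha> = 0 then KL q p
     else if \<alpha> = 1 then KL p q
     else 1 / (\<alpha> * (\<alpha> - 1)) *
       ln (\<Sum>x\<in>set_pmf p \<inter> set_pmf q. pmf p x powr \<alpha> * pmf q x powr (1 - \<alpha>)))"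

definition renyi_defined :: "real \<Rightarrow> 'a::finite pmf \<Rightarrow> 'a pmf \<Rightarrow> bool" where
  "renyi_defined \<alpha> p q \<longleftrightarrow>
    (if \<alpha> \<le> 0 then set_pmf q \<subseteq> set_pmf p
     else if \<alpha> < 1 then set_pmf p \<inter> set_pmf q \<noteq> {}
     else set_pmf p \<subseteq> set_pmf q)"

end

theory Submission
  imports Defs
begin

text \<open>
  Write \<open>P\<close> for \<open>\<pi>\<^sub>0\<close>, \<open>q\<close> for \<open>\<pi>\<close> and put \<open>A = \<Sum> P powr \<alpha> * q powr (1 - \<alpha>)\<close>,
  \<open>B = \<Sum> q * exp (\<alpha> * f)\<close>, \<open>C = \<Sum> P * exp ((\<alpha> - 1) * f)\<close>, summed over the common support.
  The summands satisfy \<open>a * b powr (\<alpha> - 1) = c powr \<alpha>\<close>, so one of the three is a weighted geometric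
  mean of the other two: \<open>c\<close> if \<open>\<alpha> > 1\<close>, \<open>a\<close> if \<open>0 < \<alpha> < 1\<close>, and \<open>b\<close> if \<open>\<alpha> < 0\<close>.  Hoelder's
  inequality gives the lower bound in each case.  The support condition ensures that passing from
  the common support to the full supports in \<open>B\<close> and \<open>C\<close> only helps.  The cases \<open>\<alpha> = 0\<close> and
  \<open>\<alpha> = 1\<close> are instances of the Donsker-Varadhan inequality.
\<close>

section \<open>Hoelder and Donsker-Varadhan inequalities\<close>

text \<open>After scaling \<open>a\<close> and \<open>b\<close> to sum 1, the weighted AM-GM
  inequality holds termwise, and its right-hand side sums to \<open>t + (1 - t) = 1\<close>. The
  relation \<open>c = a powr t * b powr (1 - t)\<close> is assumed in logarithmic form, so that each
  use reduces to a linear identity between logarithms.\<close>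

lemma ln_sum_Hoelder:
  fixes a b c :: "'a \<Rightarrow> real"
  assumes "finite S" "S \<noteq> {}" and t: "0 \<le> t" "t \<le> 1"
    and pos: "\<And>x. x \<in> S \<Longrightarrow> a x > 0" "\<And>x. x \<in> S \<Longrightarrow> b x > 0" "\<And>x. x \<in> S \<Longrightarrow> c x > 0"
    and mean: "\<And>x. x \<in> S \<Longrightarrow> ln (c x) = t * ln (a x) + (1 - t) * ln (b x)"
  shows "ln (sum c S) \<le> t * ln (sum a S) + (1 - t) * ln (sum b S)"
proof -
  let ?A = "sum a S" and ?B = "sum b S"
  let ?M = "?A powr t * ?B powr (1 - t)"
  have A: "?A > 0" and B: "?B > 0" and C: "sum c S > 0"
    using assms by (auto intro!: sum_pos)
  have M: "?M > 0" using A B by simp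
  have "c x \<le> ?M * (t * (a x / ?A) + (1 - t) * (b x / ?B))" if x: "x \<in> S" for x
  proof -
    have "c x = exp (t * ln (a x) + (1 - t) * ln (b x))"
      using pos(3)[OF x] mean[OF x] by (metis exp_ln)
    also have "\<dots> = ?M * ((a x / ?A) powr t * (b x / ?B) powr (1 - t))"
      using pos[OF x] A B by (simp add: powr_def ln_div exp_add [symmetric] algebra_simps)
    also have "\<dots> \<le> ?M * (t * (a x / ?A) + (1 - t) * (b x / ?B))"
      using Youngs_inequality_0[of t "1 - t" "a x / ?A" "b x / ?B"] t pos[OF x] A B M
      by (intro mult_left_mono) auto
    finally show ?thesis .
  qed
  then have "sum c S \<le> (\<Sum>x\<in>S. ?M * (t * (a x / ?A) + (1 - t) * (b x / ?B)))"
    by (rule sum_mono)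
  also have "\<dots> = ?M * (t * (?A / ?A) + (1 - t) * (?B / ?B))"
    by (simp only: sum.distrib flip: sum_distrib_left sum_divide_distrib)
  also have "\<dots> = ?M"
    using A B by simp
  finally have "ln (sum c S) \<le> ln ?M"
    using C M by simp
  also have "\<dots> = t * ln ?A + (1 - t) * ln ?B"
    using A B by (simp add: ln_mult ln_powr)
  finally show ?thesis .
qed

lemma expectation_finite:
  fixes p :: "'a::finite pmf" and f :: "'a \<Rightarrow> real"
  shows "measure_pmf.expectation p f = (\<Sum>x\<in>set_pmf p. pmf p x * f x)"
  by (subst integral_measure_pmf[of "set_pmf p"]) auto

lemma sum_pmf_exp_pos:
  fixes p :: "'a::finite pmf" and h :: "'a \<Rightarrow> real"
  shows "(\<Sum>x\<in>set_pmf p. pmf p x * exp (h x)) > 0"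
  by (intro sum_pos) (auto simp: set_pmf_not_empty pmf_positive)

lemma KL_support:
  fixes p q :: "'a::finite pmf"
  shows "KL p q = (\<Sum>x\<in>set_pmf p. pmf p x * ln (pmf p x / pmf q x))"
  unfolding KL_def by (rule sum.mono_neutral_right) (auto simp: pmf_eq_0_set_pmf)

text \<open>Apply \<open>ln u \<le> u - 1\<close> to \<open>u = q * exp h / (p * Z)\<close>, weight
  by \<open>p\<close> and sum over the support of \<open>p\<close>. The support inclusion makes the
  resulting sum of \<open>q * exp h\<close> a partial sum of \<open>Z\<close>, so the bound is at
  most \<open>Z / Z - 1 = 0\<close>.\<close>

lemma Donsker_Varadhan_le:
  fixes p q :: "'a::finite pmf" and h :: "'a \<Rightarrow> real"
  assumes supp: "set_pmf p \<subseteq> set_pmf q"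
  shows "(\<Sum>x\<in>set_pmf p. pmf p x * h x)
    \<le> KL p q + ln (\<Sum>x\<in>set_pmf q. pmf q x * exp (h x))"
proof -
  define Z where "Z = (\<Sum>x\<in>set_pmf q. pmf q x * exp (h x))"
  have Z: "Z > 0"
    unfolding Z_def by (rule sum_pmf_exp_pos)
  have one: "(\<Sum>x\<in>set_pmf p. pmf p x) = 1"
    by (rule sum_pmf_eq_1) auto
  have term_le: "pmf p x * (h x - ln (pmf p x / pmf q x) - ln Z) \<le> pmf q x * exp (h x) / Z - pmf p x"
    if x: "x \<in> set_pmf p" for x
  proof -
    have p: "pmf p x > 0" and q: "pmf q x > 0"
      using x supp by (auto intro: pmf_positive)
    have "h x - ln (pmf p x / pmf q x) - ln Z = ln (pmf q x * exp (h x) / (pmf p x * Z))"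
      using p q Z by (simp add: ln_div ln_mult)
    also have "\<dots> \<le> pmf q x * exp (h x) / (pmf p x * Z) - 1"
      using p q Z by (intro ln_le_minus_one) simp
    finally have "pmf p x * (h x - ln (pmf p x / pmf q x) - ln Z)
        \<le> pmf p x * (pmf q x * exp (h x) / (pmf p x * Z) - 1)"
      using p by (intro mult_left_mono) auto
    also have "\<dots> = pmf q x * exp (h x) / Z - pmf p x"
      using p Z by (simp add: field_simps)
    finally show ?thesis .
  qed
  have "(\<Sum>x\<in>set_pmf p. pmf p x * h x) - KL p q - ln Z
      = (\<Sum>x\<in>set_pmf p. pmf p x * (h x - ln (pmf p x / pmf q x) - ln Z))"
    by (simp add: KL_support right_diff_distrib sum_subtractf one flip: sum_distrib_right)
  also have "\<dots> \<le> (\<Sum>x\<in>set_pmf p. pmf q x * exp (h x) / Z - pmf p x)"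
    by (rule sum_mono) (rule term_le)
  also have "\<dots> = (\<Sum>x\<in>set_pmf p. pmf q x * exp (h x)) / Z - 1"
    by (simp add: sum_subtractf one sum_divide_distrib)
  also have "\<dots> \<le> Z / Z - 1"
    unfolding Z_def
    by (intro diff_right_mono divide_right_mono sum_mono2 sum_nonneg) (use supp in auto)
  also have "\<dots> = 0"
    using Z by simp
  finally show ?thesis
    by (simp add: Z_def)
qed

section \<open>Lower bound for every admissible distribution\<close>

lemma Psi_nonzero:
  fixes p :: "'a::finite pmf"
  assumes "\<beta> \<noteq> 0"
  shows "Psi \<beta> p f = ln (\<Sum>x\<in>set_pmf p. pmf p x * exp (\<beta> * f x)) / \<beta>"
  using assms by (simp add: Psi_def expectation_finite)

lemma Psi_zero:
  fixes p :: "'a::finite pmf"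
  shows "Psi 0 p f = (\<Sum>x\<in>set_pmf p. pmf p x * f x)"
  by (simp add: Psi_def expectation_finite)

lemma Psi_le_renyi_div:
  fixes P q :: "'a::finite pmf" and f :: "'a \<Rightarrow> real"
  assumes def: "renyi_defined \<alpha> P q"
  shows "Psi (\<alpha> - 1) P f \<le> renyi_div \<alpha> P q + Psi \<alpha> q f"
proof -
  consider "\<alpha> = 0" | "\<alpha> = 1" | "\<alpha> \<noteq> 0" "\<alpha> \<noteq> 1" by blast
  then show ?thesis
  proof cases
    case 1
    then show ?thesis
      \<comment> \<open>Here the divergence is \<open>KL q P\<close>, so the roles are swapped; the
        sign of \<open>f\<close> changes because \<open>Psi (-1) P f\<close> is minus the logarithm
        of the mean of \<open>exp (- f)\<close> under \<open>P\<close>.\<close>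
      using def Donsker_Varadhan_le[of q P "\<lambda>x. - f x"]
      by (simp add: renyi_defined_def renyi_div_def Psi_zero Psi_nonzero sum_negf)
  next
    case 2
    then show ?thesis
      using def Donsker_Varadhan_le[of P q f]
      by (simp add: renyi_defined_def renyi_div_def Psi_zero Psi_nonzero)
  next
    case 3
    define S where "S = set_pmf P \<inter> set_pmf q"
    define a where "a x = pmf P x powr \<alpha> * pmf q x powr (1 - \<alpha>)" for x
    define b where "b x = pmf q x * exp (\<alpha> * f x)" for x
    define c where "c x = pmf P x * exp ((\<alpha> - 1) * f x)" for x
    have fin: "finite S" by simp
    have ne: "S \<noteq> {}"
      using def set_pmf_not_empty[of P] set_pmf_not_empty[of q]
      by (auto simp: S_def renyi_defined_def split: if_splits)
    have Pq: "pmf P x > 0" "pmf q x > 0" if "x \<in> S" for x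
      using that by (auto simp: S_def intro: pmf_positive)
    have pos: "a x > 0" "b x > 0" "c x > 0" if "x \<in> S" for x
      using Pq[OF that] by (simp_all add: a_def b_def c_def)
    have lns: "ln (a x) = \<alpha> * ln (pmf P x) + (1 - \<alpha>) * ln (pmf q x)"
      "ln (b x) = ln (pmf q x) + \<alpha> * f x"
      "ln (c x) = ln (pmf P x) + (\<alpha> - 1) * f x" if "x \<in> S" for x
      using Pq[OF that] by (simp_all add: a_def b_def c_def ln_mult ln_powr)
    have b_le: "ln (sum b S) \<le> ln (sum b (set_pmf q))"
      using sum_pos[OF fin ne, of b] pos
      by (intro ln_mono sum_mono2) (auto simp: S_def b_def)
    have c_le: "ln (sum c S) \<le> ln (sum c (set_pmf P))"
      using sum_pos[OF fin ne, of c] pos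
      by (intro ln_mono sum_mono2) (auto simp: S_def c_def)
    \<comment> \<open>Over the common denominator \<open>\<alpha> * (\<alpha> - 1)\<close> the claim
      compares \<open>\<alpha> * ln C\<close> with \<open>ln A + (\<alpha> - 1) * ln B\<close>. The
      denominator is negative exactly for \<open>0 < \<alpha> < 1\<close>, where the comparison of
      numerators is reversed.\<close>
    have goal_iff: "?thesis \<longleftrightarrow> ln (sum c (set_pmf P)) / (\<alpha> - 1)
        \<le> (ln (sum a S) + (\<alpha> - 1) * ln (sum b (set_pmf q))) / (\<alpha> * (\<alpha> - 1))"
      using 3 unfolding a_def[abs_def] b_def[abs_def] c_def[abs_def] S_def
      by (simp add: renyi_div_def Psi_nonzero add_divide_distrib)
    consider "\<alpha> < 0" | "0 < \<alpha>" "\<alpha> < 1" | "\<alpha> > 1" using 3 by linarith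
    then show ?thesis
    proof cases
      case 1
      then have S: "S = set_pmf q"
        using def by (auto simp: S_def renyi_defined_def)
      have w: "1 - 1 / (1 - \<alpha>) = - \<alpha> / (1 - \<alpha>)"
        using 1 by (simp add: field_simps)
      \<comment> \<open>The weights come from solving
        \<open>a * b powr (\<alpha> - 1) = c powr \<alpha>\<close> for \<open>b\<close>. Since
        \<open>S\<close> is the support of \<open>q\<close>, only the sum of \<open>c\<close> has to
        be extended afterwards, and its coefficient \<open>- \<alpha>\<close> is positive.\<close>
      have "ln (sum b S) \<le> 1 / (1 - \<alpha>) * ln (sum a S) + (1 - 1 / (1 - \<alpha>)) * ln (sum c S)"
      proof (intro ln_sum_Hoelder fin ne pos)
        fix x assume x: "x \<in> S"
        have "(1 - \<alpha>) * ln (b x) = ln (a x) - \<alpha> * ln (c x)"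
          by (simp add: lns[OF x] algebra_simps)
        then have "ln (b x) = (ln (a x) - \<alpha> * ln (c x)) / (1 - \<alpha>)"
          using 1 by (simp add: eq_divide_eq mult.commute)
        then show "ln (b x) = 1 / (1 - \<alpha>) * ln (a x) + (1 - 1 / (1 - \<alpha>)) * ln (c x)"
          by (simp add: w diff_divide_distrib)
      qed (use 1 in auto)
      then have "ln (sum b S) \<le> (ln (sum a S) - \<alpha> * ln (sum c S)) / (1 - \<alpha>)"
        by (simp add: w diff_divide_distrib)
      then have "(1 - \<alpha>) * ln (sum b S) \<le> ln (sum a S) - \<alpha> * ln (sum c S)"
        using 1 by (simp add: pos_le_divide_eq mult.commute)
      moreover have "- \<alpha> * ln (sum c S) \<le> - \<alpha> * ln (sum c (set_pmf P))"
        using 1 c_le by (intro mult_left_mono) auto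
      ultimately have "\<alpha> * ln (sum c (set_pmf P)) \<le> ln (sum a S) + (\<alpha> - 1) * ln (sum b S)"
        by (simp add: algebra_simps)
      then have "\<alpha> * ln (sum c (set_pmf P)) / (\<alpha> * (\<alpha> - 1))
          \<le> (ln (sum a S) + (\<alpha> - 1) * ln (sum b S)) / (\<alpha> * (\<alpha> - 1))"
        using 1 by (intro divide_right_mono) (auto simp: mult_nonpos_nonpos)
      then show ?thesis
        unfolding goal_iff using 1 S by simp
    next
      case 2
      \<comment> \<open>\<open>S\<close> may be smaller than both supports, but \<open>b\<close> and
        \<open>c\<close> stand on the larger side with positive coefficients, so both sums can be
        extended.\<close>
      have "ln (sum a S) \<le> \<alpha> * ln (sum c S) + (1 - \<alpha>) * ln (sum b S)"
        using 2 by (intro ln_sum_Hoelder fin ne pos) (auto simp: lns algebra_simps)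
      moreover have "\<alpha> * ln (sum c S) \<le> \<alpha> * ln (sum c (set_pmf P))"
        using 2 c_le by (intro mult_left_mono) auto
      moreover have "(1 - \<alpha>) * ln (sum b S) \<le> (1 - \<alpha>) * ln (sum b (set_pmf q))"
        using 2 b_le by (intro mult_left_mono) auto
      ultimately have "ln (sum a S) + (\<alpha> - 1) * ln (sum b (set_pmf q)) \<le> \<alpha> * ln (sum c (set_pmf P))"
        by (simp add: algebra_simps)
      then have "\<alpha> * ln (sum c (set_pmf P)) / (\<alpha> * (\<alpha> - 1))
          \<le> (ln (sum a S) + (\<alpha> - 1) * ln (sum b (set_pmf q))) / (\<alpha> * (\<alpha> - 1))"
        using 2 by (intro divide_right_mono_neg) (auto simp: mult_nonneg_nonpos)
      then show ?thesis
        unfolding goal_iff using 2 by simp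
    next
      case 3
      then have S: "S = set_pmf P"
        using def by (auto simp: S_def renyi_defined_def)
      \<comment> \<open>Solving for \<open>c\<close> gives the weight \<open>1 / \<alpha>\<close>.
        Now \<open>S\<close> is the support of \<open>P\<close>, and only the sum of
        \<open>b\<close> is extended.\<close>
      have "ln (sum c S) \<le> 1 / \<alpha> * ln (sum a S) + (1 - 1 / \<alpha>) * ln (sum b S)"
        using 3 by (intro ln_sum_Hoelder fin ne pos) (auto simp: lns field_simps)
      then have "\<alpha> * ln (sum c S) \<le> ln (sum a S) + (\<alpha> - 1) * ln (sum b S)"
        using 3 by (simp add: field_simps)
      moreover have "(\<alpha> - 1) * ln (sum b S) \<le> (\<alpha> - 1) * ln (sum b (set_pmf q))"
        using 3 b_le by (intro mult_left_mono) auto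
      ultimately have "\<alpha> * ln (sum c S) \<le> ln (sum a S) + (\<alpha> - 1) * ln (sum b (set_pmf q))"
        by linarith
      then have "\<alpha> * ln (sum c S) / (\<alpha> * (\<alpha> - 1))
          \<le> (ln (sum a S) + (\<alpha> - 1) * ln (sum b (set_pmf q))) / (\<alpha> * (\<alpha> - 1))"
        using 3 by (intro divide_right_mono) auto
      then show ?thesis
        unfolding goal_iff using 3 S by simp
    qed
  qed
qed

section \<open>The minimizer and its value\<close>

text \<open>\<open>Psi 1 P h\<close> is the logarithm of the normalizing sum of
  \<open>P * exp h\<close>, so the tilted weights add up to 1.\<close>

lemma exp_tilt_exists:
  fixes P :: "'a::finite pmf" and h :: "'a \<Rightarrow> real"
  shows "\<exists>q. \<forall>x. pmf q x = pmf P x * exp (h x - Psi 1 P h)"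
proof -
  let ?Z = "\<Sum>x\<in>set_pmf P. pmf P x * exp (h x)"
  let ?w = "\<lambda>x. pmf P x * exp (h x - Psi 1 P h)"
  have Z: "?Z > 0" by (rule sum_pmf_exp_pos)
  have "sum ?w UNIV = sum ?w (set_pmf P)"
    by (rule sum.mono_neutral_right) (auto simp: pmf_eq_0_set_pmf)
  also have "\<dots> = ?Z / ?Z"
    using Z by (simp add: Psi_nonzero exp_diff flip: sum_divide_distrib)
  finally have "sum ?w UNIV = 1"
    using Z by simp
  then have "(\<integral>\<^sup>+x. ennreal (?w x) \<partial>count_space UNIV) = 1"
    by (subst nn_integral_count_space_finite) (auto simp: sum_ennreal)
  then have "\<forall>x. pmf (embed_pmf ?w) x = ?w x"
    by (intro allI pmf_embed_pmf) auto
  then show ?thesis by blast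
qed

text \<open>This is the equality case of Hoelder: for the tilted \<open>q\<close> the summands of
  \<open>A\<close> and \<open>B\<close> are those of \<open>C\<close> times
  \<open>exp ((\<alpha> - 1) * L)\<close> and \<open>exp (- L)\<close>. The tilt keeps the support,
  so the divergence is defined for every \<alpha>.\<close>

lemma renyi_div_exp_tilt:
  fixes P q :: "'a::finite pmf" and f :: "'a \<Rightarrow> real"
  assumes q: "\<And>x. pmf q x = pmf P x * exp (- f x - L)"
  shows "renyi_div \<alpha> P q + Psi \<alpha> q f = Psi (\<alpha> - 1) P f"
    and "renyi_defined \<alpha> P q"
proof -
  have supp: "set_pmf q = set_pmf P"
    by (auto simp: set_pmf_iff q)
  show "renyi_defined \<alpha> P q"
    by (simp add: renyi_defined_def supp set_pmf_not_empty)
  \<comment> \<open>Normalization of \<open>q\<close> forces the value of \<open>L\<close>. It is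
    needed for \<open>\<alpha> = 0\<close>, where both sides equal \<open>- L\<close>; in the other
    cases \<open>L\<close> cancels.\<close>
  have L: "L = ln (\<Sum>x\<in>set_pmf P. pmf P x * exp (- f x))"
  proof -
    have "1 = (\<Sum>x\<in>set_pmf P. pmf q x)"
      using sum_pmf_eq_1[of "set_pmf P" q] by (simp add: supp)
    also have "\<dots> = (\<Sum>x\<in>set_pmf P. pmf P x * exp (- f x)) * exp (- L)"
      by (simp add: q exp_diff exp_minus sum_distrib_right divide_inverse mult.assoc)
    finally have "(\<Sum>x\<in>set_pmf P. pmf P x * exp (- f x)) = exp L"
      by (simp add: exp_minus field_simps)
    then show ?thesis by simp
  qed
  have oneP: "(\<Sum>x\<in>set_pmf P. pmf P x) = 1" and oneq: "(\<Sum>x\<in>set_pmf P. pmf q x) = 1"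
    by (auto intro!: sum_pmf_eq_1 simp: supp)
  have exp_sum: "(\<Sum>x\<in>set_pmf P. pmf q x * exp (\<alpha> * f x))
      = (\<Sum>x\<in>set_pmf P. pmf P x * exp ((\<alpha> - 1) * f x)) * exp (- L)"
    unfolding sum_distrib_right
    by (rule sum.cong) (simp_all add: q mult.assoc exp_add [symmetric] left_diff_distrib)
  consider "\<alpha> = 0" | "\<alpha> = 1" | "\<alpha> \<noteq> 0" "\<alpha> \<noteq> 1" by blast
  then show "renyi_div \<alpha> P q + Psi \<alpha> q f = Psi (\<alpha> - 1) P f"
  proof cases
    case 1
    have "KL q P = (\<Sum>x\<in>set_pmf P. pmf q x * (- f x - L))"
      unfolding KL_support supp by (rule sum.cong) (auto simp: q set_pmf_iff)
    also have "\<dots> = - (\<Sum>x\<in>set_pmf P. pmf q x * f x) - L"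
      by (simp add: right_diff_distrib sum_subtractf sum_negf oneq flip: sum_distrib_right)
    finally show ?thesis
      using 1 by (simp add: renyi_div_def Psi_zero Psi_nonzero supp L)
  next
    case 2
    have "KL P q = (\<Sum>x\<in>set_pmf P. pmf P x * (f x + L))"
      unfolding KL_support
    proof (rule sum.cong)
      fix x assume "x \<in> set_pmf P"
      then have "pmf P x / pmf q x = exp (f x + L)"
        by (simp add: q set_pmf_iff exp_diff exp_add exp_minus field_simps)
      then show "pmf P x * ln (pmf P x / pmf q x) = pmf P x * (f x + L)" by simp
    qed simp
    also have "\<dots> = (\<Sum>x\<in>set_pmf P. pmf P x * f x) + L"
      by (simp add: distrib_left sum.distrib oneP flip: sum_distrib_right)
    finally show ?thesis
      using 2 exp_sum by (simp add: renyi_div_def Psi_zero Psi_nonzero supp oneP)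
  next
    case 3
    let ?C = "\<Sum>x\<in>set_pmf P. pmf P x * exp ((\<alpha> - 1) * f x)"
    have C: "?C > 0" by (rule sum_pmf_exp_pos)
    have "(\<Sum>x\<in>set_pmf P. pmf P x powr \<alpha> * pmf q x powr (1 - \<alpha>))
        = (\<Sum>x\<in>set_pmf P. pmf P x * exp ((\<alpha> - 1) * f x) * exp ((\<alpha> - 1) * L))"
    proof (rule sum.cong)
      fix x assume "x \<in> set_pmf P"
      then have P: "pmf P x > 0" by (rule pmf_positive)
      have "pmf P x powr \<alpha> * pmf q x powr (1 - \<alpha>)
          = (pmf P x powr \<alpha> * pmf P x powr (1 - \<alpha>)) * exp ((1 - \<alpha>) * (- f x - L))"
        by (simp add: q powr_mult exp_powr_real mult_ac)
      also have "\<dots> = pmf P x * (exp ((\<alpha> - 1) * f x) * exp ((\<alpha> - 1) * L))"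
        using P by (simp add: powr_add [symmetric] exp_add [symmetric] algebra_simps)
      finally show "pmf P x powr \<alpha> * pmf q x powr (1 - \<alpha>)
          = pmf P x * exp ((\<alpha> - 1) * f x) * exp ((\<alpha> - 1) * L)" by simp
    qed simp
    then have "ln (\<Sum>x\<in>set_pmf P. pmf P x powr \<alpha> * pmf q x powr (1 - \<alpha>)) = ln ?C + (\<alpha> - 1) * L"
      using C by (simp add: ln_mult flip: sum_distrib_right)
    moreover have "ln (\<Sum>x\<in>set_pmf P. pmf q x * exp (\<alpha> * f x)) = ln ?C - L"
      unfolding exp_sum using C by (simp add: ln_mult)
    \<comment> \<open>The terms in \<open>L\<close> cancel in
      \<open>ln A + (\<alpha> - 1) * ln B\<close>, leaving \<open>\<alpha> * ln C\<close>.\<close>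
    ultimately show ?thesis
      using 3 by (simp add: renyi_div_def Psi_nonzero supp) (simp add: field_simps)
  qed
qed

theorem theorem5:
  fixes \<pi>\<^sub>0 :: "'a::finite pmf" and f :: "'a \<Rightarrow> real" and \<alpha> :: real
  shows "\<exists>\<pi>' :: 'a pmf.
    (\<forall>x. pmf \<pi>' x = pmf \<pi>\<^sub>0 x * exp (- f x - Psi 1 \<pi>\<^sub>0 (\<lambda>y. - f y))) \<and>
    is_arg_min (\<lambda>\<pi>. renyi_div \<alpha> \<pi>\<^sub>0 \<pi> + Psi \<alpha> \<pi> f) (\<lambda>\<pi>. renyi_defined \<alpha> \<pi>\<^sub>0 \<pi>) \<pi>' \<and>
    renyi_div \<alpha> \<pi>\<^sub>0 \<pi>' + Psi \<alpha> \<pi>' f = Psi (\<alpha> - 1) \<pi>\<^sub>0 f"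
proof -
  obtain q where q: "\<And>x. pmf q x = pmf \<pi>\<^sub>0 x * exp (- f x - Psi 1 \<pi>\<^sub>0 (\<lambda>y. - f y))"
    using exp_tilt_exists[of \<pi>\<^sub>0 "\<lambda>y. - f y"] by blast
  \<comment> \<open>The tilted distribution is admissible and attains the lower bound, hence is a
    minimizer.\<close>
  show ?thesis
    using q renyi_div_exp_tilt[OF q]
    by (intro exI[of _ q]) (simp add: is_arg_min_linorder Psi_le_renyi_div)
qed

end
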